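(* For every integer $n\ge 3$, let $C_n$ be the cycle graph on $n$ vertices and let $Sp(C_n)$ be its splitting graph. Then $$\gamma_{ds}(Sp(C_n))=\begin{cases} n, & \text{if } n\equiv 0 \pmod 4,\\ n+1, & \text{otherwise}.\end{cases}$$
   Context: All graphs are finite, simple and undirected. A set $S\subseteq V(G)$ is a dual-server dominating set (DS-dominating set) of a graph $G$ if there is a partition $\{R,B\}$ of $S$ such that every vertex of $V(G)\setminus S$ has at least one neighbour in $R$ and at least one neighbour in $B$. The dual-server domination number $\gamma_{ds}(G)$ is the minimum cardinality of a DS-dominating set of $G$. The splitting graph $Sp(G)$ of $G$ is obtained from $G$ by adding, for each vertex $v\in V(G)$, a new vertex $v'$ (the twin of $v$) adjacent exactly to the vertices of the open neighbourhood $N_G(v)$ of $v$ in $G$ (so twins are pairwise nonadjacent, and $v'$ is not adjacent to $v$). *)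

theory Defs
  imports Main
begin

text \<open>A graph is given by its vertex set together with a set of edges, an edge being the
  two-element set of its end vertices.\<close>

record 'a graph =
  verts :: "'a set"
  edges :: "'a set set"

definition simple_graph :: "'a graph \<Rightarrow> bool" where
  "simple_graph G \<longleftrightarrow>
     finite (verts G) \<and> (\<forall>e\<in>edges G. e \<subseteq> verts G \<and> card e = 2)"

definition neighbourhood :: "'a graph \<Rightarrow> 'a \<Rightarrow> 'a set" where
  "neighbourhood G v = {u \<in> verts G. {u, v} \<in> edges G}"

text \<open>Both parts of a partition are nonempty. This matters only for graphs with fewer than two
  vertices: a vertex outside \<open>S\<close> already has a neighbour in each part.\<close>

definition ds_dominating :: "'a graph \<Rightarrow> 'a set \<Rightarrow> bool" where
  "ds_dominating G S \<longleftrightarrow>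
     S \<subseteq> verts G \<and>
     (\<exists>R B. R \<union> B = S \<and> R \<inter> B = {} \<and> R \<noteq> {} \<and> B \<noteq> {} \<and>
        (\<forall>v \<in> verts G - S. neighbourhood G v \<inter> R \<noteq> {} \<and> neighbourhood G v \<inter> B \<noteq> {}))"

definition ds_domination_number :: "'a graph \<Rightarrow> nat" where
  "ds_domination_number G = (LEAST k. \<exists>S. ds_dominating G S \<and> card S = k)"

definition cycle_graph :: "nat \<Rightarrow> nat graph" where
  "cycle_graph n = \<lparr>verts = {..<n}, edges = {{i, (i + 1) mod n} | i. i < n}\<rparr>"

text \<open>\<open>Inl v\<close> is the original vertex \<open>v\<close> and \<open>Inr v\<close> is its twin.\<close>

definition splitting_graph :: "'a graph \<Rightarrow> ('a + 'a) graph" where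
  "splitting_graph G =
     \<lparr>verts = Inl ` verts G \<union> Inr ` verts G,
      edges = ((`) Inl) ` edges G \<union>
        {{Inr v, Inl u} | u v. v \<in> verts G \<and> u \<in> neighbourhood G v}\<rparr>"

lemma simple_graph_cycle_graph:
  assumes "n \<ge> 3"
  shows "simple_graph (cycle_graph n)"
proof -
  have "i \<noteq> (i + 1) mod n" if "i < n" for i
    using that assms by (cases "i + 1 = n") auto
  then have "card {i, (i + 1) mod n} = 2" if "i < n" for i
    using that by (simp only: card_2_iff) blast
  moreover have "(i + 1) mod n < n" for i
    using assms by simp
  ultimately show ?thesis
    unfolding simple_graph_def cycle_graph_def by (auto simp del: Suc_eq_plus1 add_Suc_right One_nat_def)
qed

lemma simple_graph_splitting_graph:
  assumes "simple_graph G"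
  shows "simple_graph (splitting_graph G)"
  using assms
  by (auto simp: simple_graph_def splitting_graph_def neighbourhood_def card_image)

lemma neighbourhood_splitting_graph:
  assumes "v \<in> verts G"
  shows "neighbourhood (splitting_graph G) (Inl v) =
           Inl ` neighbourhood G v \<union> Inr ` neighbourhood G v"
    and "neighbourhood (splitting_graph G) (Inr v) = Inl ` neighbourhood G v"
proof -
  have inl: "({Inl x, Inl y} = Inl ` e) = (e = {x, y})" for x y :: 'a and e
    using inj_image_eq_iff[OF inj_Inl, of "{x, y}" e] by auto
  have inr: "{Inr x, z} \<noteq> Inl ` e" "{z, Inr x} \<noteq> Inl ` e"
    for x :: 'a and z :: "'a + 'a" and e :: "'a set"
    by (auto simp: set_eq_iff)
  have nb: "v \<in> neighbourhood G u \<longleftrightarrow> u \<in> neighbourhood G v" if "u \<in> verts G" for u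
    using that assms by (simp add: neighbourhood_def insert_commute)
  have "u \<in> neighbourhood (splitting_graph G) (Inl v) \<longleftrightarrow>
          u \<in> Inl ` neighbourhood G v \<union> Inr ` neighbourhood G v" for u
    using assms nb
    by (cases u)
      (auto simp: neighbourhood_def splitting_graph_def image_iff inl inr doubleton_eq_iff)
  then show "neighbourhood (splitting_graph G) (Inl v) =
          Inl ` neighbourhood G v \<union> Inr ` neighbourhood G v"
    by blast
  have "u \<in> neighbourhood (splitting_graph G) (Inr v) \<longleftrightarrow> u \<in> Inl ` neighbourhood G v" for u
    using assms
    by (cases u)
      (auto simp: neighbourhood_def splitting_graph_def image_iff inl inr doubleton_eq_iff)
  then show "neighbourhood (splitting_graph G) (Inr v) = Inl ` neighbourhood G v"
    by blast
qed

lemma ds_dominating_verts: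
  assumes "simple_graph G" and "card (verts G) \<ge> 2"
  shows "ds_dominating G (verts G)"
proof -
  obtain x where x: "x \<in> verts G"
    using assms(2) by fastforce
  have "verts G - {x} \<noteq> {}"
    using assms x by (auto simp: simple_graph_def dest!: subset_singletonD)
  then show ?thesis
    using x unfolding ds_dominating_def
    by (intro conjI exI[of _ "{x}"] exI[of _ "verts G - {x}"]) auto
qed

end

theory Submission
  imports Defs
begin

text \<open>
  Write \<open>O\<close> and \<open>T\<close> for the sets of indices of the original vertices and of the twins in a
  DS-dominating set \<open>S\<close>, so that \<open>card S = card O + card T\<close>. A twin outside \<open>S\<close> with index \<open>i\<close>
  sees only the originals \<open>i - 1\<close> and \<open>i + 1\<close>; both must lie in \<open>S\<close>, with different colours.
  Hence the shift \<open>i \<mapsto> i + 1\<close> maps the complement of \<open>T\<close> injectively into \<open>O\<close>, and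
  \<open>card S \<ge> n\<close>.

  If \<open>card S = n\<close>, both shifts map the complement of \<open>T\<close> onto \<open>O\<close>. Then \<open>O\<close> is closed
  under \<open>j \<mapsto> j + 2\<close>, and the colour changes at each such step. If \<open>O\<close> is empty, every twin is
  in \<open>S\<close> and every original is outside, so that the colours of the twins alternate in the same
  way. A nonempty set of residues modulo \<open>n\<close> with this property forces \<open>4 dvd n\<close>, because
  otherwise an odd number of steps of length two leads back to the starting point
  (lemma \<open>alternating_step_two\<close>).

  For the upper bound, colour the index \<open>i\<close> by whether \<open>i mod 4 < 2\<close>. The colours at \<open>i - 1\<close>
  and \<open>i + 1\<close> then differ except possibly where the cycle closes up: there is no exception if
  \<open>4 dvd n\<close>, and exactly one if \<open>n\<close> is odd. So all originals, together with the exceptional twin,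
  dominate. If \<open>n mod 4 = 2\<close> there are two exceptions; here one takes the originals and
  twins of all even indices, twins coloured opposite to their originals, and one odd twin.
\<close>

section \<open>Neighbourhoods and colour alternation\<close>

lemma neighbourhood_cycle_graph:
  assumes "n \<ge> 3" and "i < n"
  shows "neighbourhood (cycle_graph n) i = {(i + n - 1) mod n, (i + 1) mod n}"
proof -
  have step: "i = (u + 1) mod n \<longleftrightarrow> u = (i + n - 1) mod n" if "u < n" for u
    using assms that by (auto simp: mod_if)
  have "u \<in> neighbourhood (cycle_graph n) i \<longleftrightarrow>
          u < n \<and> (u = (i + 1) mod n \<or> i = (u + 1) mod n)" for u
    using assms(2)
    by (auto simp: neighbourhood_def cycle_graph_def doubleton_eq_iff)
  then show ?thesis
    using step assms by auto
qed

lemma verts_splitting_cycle: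
  "verts (splitting_graph (cycle_graph n)) = Inl ` {..<n} \<union> Inr ` {..<n}"
  by (simp add: splitting_graph_def cycle_graph_def)

lemma neighbourhood_splitting_cycle:
  assumes "n \<ge> 3" and "i < n"
  shows "neighbourhood (splitting_graph (cycle_graph n)) (Inl i) =
           {Inl ((i + n - 1) mod n), Inl ((i + 1) mod n),
            Inr ((i + n - 1) mod n), Inr ((i + 1) mod n)}"
    and "neighbourhood (splitting_graph (cycle_graph n)) (Inr i) =
           {Inl ((i + n - 1) mod n), Inl ((i + 1) mod n)}"
proof -
  have "i \<in> verts (cycle_graph n)"
    using assms by (simp add: cycle_graph_def)
  from neighbourhood_splitting_graph[OF this] neighbourhood_cycle_graph[OF assms]
  show "neighbourhood (splitting_graph (cycle_graph n)) (Inl i) =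
           {Inl ((i + n - 1) mod n), Inl ((i + 1) mod n),
            Inr ((i + n - 1) mod n), Inr ((i + 1) mod n)}"
    and "neighbourhood (splitting_graph (cycle_graph n)) (Inr i) =
           {Inl ((i + n - 1) mod n), Inl ((i + 1) mod n)}"
    by auto
qed

lemma alternating_step_two:
  fixes n :: nat and c :: "nat \<Rightarrow> bool"
  assumes j: "j \<in> X" "j < n"
    and step: "\<And>i. i \<in> X \<Longrightarrow> (i + 2) mod n \<in> X \<and> c ((i + 2) mod n) \<noteq> c i"
  shows "4 dvd n"
proof (rule ccontr)
  assume not4: "\<not> 4 dvd n"
  have walk: "(j + 2 * k) mod n \<in> X \<and> (c ((j + 2 * k) mod n) = c j \<longleftrightarrow> even k)" for k
  proof (induction k)
    case 0
    then show ?case using j by simp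
  next
    case (Suc k)
    have "(j + 2 * Suc k) mod n = ((j + 2 * k) mod n + 2) mod n"
      by (simp add: mod_simps algebra_simps)
    then show ?case
      using Suc step[of "(j + 2 * k) mod n"] by auto
  qed
  \<comment> \<open>An odd number of double steps that goes around the cycle once or twice.\<close>
  obtain k where "odd k" and "n dvd 2 * k"
  proof (cases "odd n")
    case True
    then show ?thesis using that[of n] by simp
  next
    case False
    then obtain m where "n = 2 * m" by blast
    with not4 have "odd m" by auto
    with \<open>n = 2 * m\<close> show ?thesis using that[of m] by simp
  qed
  then have "(j + 2 * k) mod n = j"
    using j(2) by auto
  with walk[of k] \<open>odd k\<close> show False by simp
qed

section \<open>The lower bound\<close>

lemma ds_dominating_splitting_cycle_card:
  assumes n: "n \<ge> 3"
    and S: "ds_dominating (splitting_graph (cycle_graph n)) S"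
  shows "n \<le> card S" and "card S = n \<Longrightarrow> 4 dvd n"
proof -
  let ?G = "splitting_graph (cycle_graph n)"
  define p where "p i = (i + 1) mod n" for i
  define q where "q i = (i + n - 1) mod n" for i
  have pq: "p (q i) = i" "q (p i) = i" if "i < n" for i
    using that n by (auto simp: p_def q_def mod_if)
  have pp: "p (p i) = (i + 2) mod n" for i
    by (simp add: p_def mod_simps)
  from S obtain R B where sub: "S \<subseteq> verts ?G" and RB: "R \<union> B = S" "R \<inter> B = {}"
    and dom: "\<And>v. v \<in> verts ?G - S \<Longrightarrow> neighbourhood ?G v \<inter> R \<noteq> {} \<and> neighbourhood ?G v \<inter> B \<noteq> {}"
    unfolding ds_dominating_def by blast
  define Or where "Or = {i. Inl i \<in> S}"
  define Tw where "Tw = {i. Inr i \<in> S}"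
  define Tc where "Tc = {..<n} - Tw"
  have fin: "Or \<subseteq> {..<n}" "Tw \<subseteq> {..<n}"
    using sub by (auto simp: Or_def Tw_def verts_splitting_cycle)
  have "S = Inl ` Or \<union> Inr ` Tw"
  proof (rule set_eqI)
    fix x show "x \<in> S \<longleftrightarrow> x \<in> Inl ` Or \<union> Inr ` Tw"
      by (cases x) (auto simp: Or_def Tw_def)
  qed
  moreover have "finite Or" "finite Tw"
    using fin finite_subset by blast+
  ultimately have cardS: "card S = card Or + card Tw"
    by (subst \<open>S = _\<close>, subst card_Un_disjoint) (auto simp: card_image)
  have cardTc: "card Tc + card Tw = n"
    using fin card_mono[of "{..<n}" Tw] \<open>finite Tw\<close> by (simp add: Tc_def card_Diff_subset)
  have twin: "p i \<in> Or \<and> q i \<in> Or \<and> (Inl (p i) \<in> R \<longleftrightarrow> Inl (q i) \<notin> R)" if "i \<in> Tc" for i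
  proof -
    from that have "i < n" "Inr i \<in> verts ?G - S"
      by (auto simp: Tc_def Tw_def verts_splitting_cycle)
    with dom[of "Inr i"] neighbourhood_splitting_cycle(2)[OF n, of i] RB show ?thesis
      by (auto simp: p_def q_def Or_def)
  qed
  have inj: "inj_on p Tc" "inj_on q Tc"
    using pq by (auto intro!: inj_on_inverseI[of _ q p] inj_on_inverseI[of _ p q] simp: Tc_def)
  have img: "p ` Tc \<subseteq> Or" "q ` Tc \<subseteq> Or"
    using twin by auto
  have "card Tc \<le> card Or"
    using card_mono[OF \<open>finite Or\<close> img(1)] inj by (simp add: card_image)
  then show "n \<le> card S"
    using cardS cardTc by simp
  assume "card S = n"
  then have "card Tc = card Or"
    using cardS cardTc by simp
  then have onto: "q ` Tc = Or"
    using img inj \<open>finite Or\<close> by (simp add: card_subset_eq card_image)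
  show "4 dvd n"
  proof (cases "Or = {}")
    case False
    then obtain j where j: "j \<in> Or" by blast
    have "(i + 2) mod n \<in> Or \<and> (Inl ((i + 2) mod n) \<in> R) \<noteq> (Inl i \<in> R)" if "i \<in> Or" for i
    proof -
      from that onto obtain k where k: "k \<in> Tc" "i = q k" by blast
      then have "p i = k"
        using pq by (auto simp: Tc_def)
      then have "(i + 2) mod n = p k"
        using pp by metis
      with twin[OF k(1)] k(2) show ?thesis by auto
    qed
    then show ?thesis
      using alternating_step_two[of j Or n "\<lambda>i. Inl i \<in> R"] j fin by auto
  next
    case True
    have "(Inr ((i + 2) mod n) \<in> R) \<noteq> (Inr i \<in> R)" if "i < n" for i
    proof -
      have pi: "p i < n" "q (p i) = i" "p (p i) = (i + 2) mod n"
        using that n pq pp by (auto simp: p_def)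
      then have "Inl (p i) \<in> verts ?G - S"
        using True by (auto simp: Or_def verts_splitting_cycle)
      moreover have "neighbourhood ?G (Inl (p i)) = {Inl i, Inl ((i + 2) mod n), Inr i, Inr ((i + 2) mod n)}"
        using neighbourhood_splitting_cycle(1)[OF n pi(1)] pi(2,3) by (simp add: p_def q_def)
      moreover have "Inl k \<notin> R \<union> B" for k
        using True RB by (auto simp: Or_def)
      ultimately show ?thesis
        using dom[of "Inl (p i)"] RB by auto
    qed
    then show ?thesis
      using alternating_step_two[of 0 "{..<n}" n "\<lambda>i. Inr i \<in> R"] n by auto
  qed
qed

section \<open>The upper bound\<close>

lemma ds_dominating_splitting_cycleI:
  assumes n: "n \<ge> 3"
    and "R \<union> B \<subseteq> Inl ` {..<n} \<union> Inr ` {..<n}" and "R \<inter> B = {}" and "R \<noteq> {}" and "B \<noteq> {}"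
    and "\<And>i. \<lbrakk>i < n; Inl i \<notin> R \<union> B\<rbrakk> \<Longrightarrow>
           {Inl ((i + n - 1) mod n), Inl ((i + 1) mod n),
            Inr ((i + n - 1) mod n), Inr ((i + 1) mod n)} \<inter> R \<noteq> {} \<and>
           {Inl ((i + n - 1) mod n), Inl ((i + 1) mod n),
            Inr ((i + n - 1) mod n), Inr ((i + 1) mod n)} \<inter> B \<noteq> {}"
    and "\<And>i. \<lbrakk>i < n; Inr i \<notin> R \<union> B\<rbrakk> \<Longrightarrow>
           {Inl ((i + n - 1) mod n), Inl ((i + 1) mod n)} \<inter> R \<noteq> {} \<and>
           {Inl ((i + n - 1) mod n), Inl ((i + 1) mod n)} \<inter> B \<noteq> {}"
  shows "ds_dominating (splitting_graph (cycle_graph n)) (R \<union> B)"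
proof -
  have "neighbourhood (splitting_graph (cycle_graph n)) v \<inter> R \<noteq> {} \<and>
        neighbourhood (splitting_graph (cycle_graph n)) v \<inter> B \<noteq> {}"
    if "v \<in> verts (splitting_graph (cycle_graph n)) - (R \<union> B)" for v
  proof (cases v)
    case (Inl i)
    then have "i < n" "Inl i \<notin> R \<union> B"
      using that by (auto simp: verts_splitting_cycle)
    then show ?thesis
      unfolding Inl neighbourhood_splitting_cycle(1)[OF n \<open>i < n\<close>] by (rule assms(6))
  next
    case (Inr i)
    then have "i < n" "Inr i \<notin> R \<union> B"
      using that by (auto simp: verts_splitting_cycle)
    then show ?thesis
      unfolding Inr neighbourhood_splitting_cycle(2)[OF n \<open>i < n\<close>] by (rule assms(7))
  qed
  then show ?thesis
    unfolding ds_dominating_def using assms(2-5)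
    by (intro conjI exI[of _ R] exI[of _ B] ballI) (simp_all add: verts_splitting_cycle)
qed

text \<open>The twins that cannot be left out are those with equally coloured neighbours; with the
  colouring by \<open>i mod 4 < 2\<close> they occur at \<open>0\<close> or \<open>n - 1\<close> only.\<close>

lemma exists_ds_dominating_not_2_mod_4:
  assumes n: "n \<ge> 3" and n2: "n mod 4 \<noteq> 2"
  shows "\<exists>S. ds_dominating (splitting_graph (cycle_graph n)) S \<and>
             card S \<le> (if n mod 4 = 0 then n else n + 1)"
proof -
  define c where "c i \<longleftrightarrow> i mod 4 < 2" for i :: nat
  define T where "T = {i. i < n \<and> c ((i + n - 1) mod n) = c ((i + 1) mod n)}"
  \<comment> \<open>The colour of the twins in \<open>T\<close> is immaterial, since all originals are chosen.\<close>
  define R :: "(nat + nat) set" where "R = Inl ` {i. i < n \<and> c i} \<union> Inr ` T"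
  define B :: "(nat + nat) set" where "B = Inl ` {i. i < n \<and> \<not> c i}"
  have inner: "c (i - 1) \<noteq> c (i + 1)" if "i > 0" for i
    using that by (cases i) (auto simp: c_def mod_Suc)
  obtain m where m: "n = Suc (Suc m)"
    using n le_Suc_ex[of 2 n] by auto
  have wrap0: "c (n - 1) = c 1 \<longleftrightarrow> n mod 4 \<in> {1, 2}"
    by (auto simp: c_def m mod_Suc)
  have wrap1: "c (n - 2) = c 0 \<longleftrightarrow> n mod 4 \<in> {2, 3}"
    by (auto simp: c_def m mod_Suc)
  have "T \<subseteq> (if n mod 4 = 0 then {} else if n mod 4 = 1 then {0} else {n - 1})"
  proof
    fix i assume i: "i \<in> T"
    consider "i = 0" | "i = n - 1" | "0 < i" "i + 1 < n"
      using i by (force simp: T_def)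
    then show "i \<in> (if n mod 4 = 0 then {} else if n mod 4 = 1 then {0} else {n - 1})"
    proof cases
      case 1
      with i n have "c (n - 1) = c 1"
        by (simp add: T_def)
      with 1 wrap0 n2 show ?thesis by auto
    next
      case 2
      then have "(i + n - 1) mod n = n - 2" "(i + 1) mod n = 0"
        using n by (simp_all add: mod_if)
      with i have "c (n - 2) = c 0"
        by (simp add: T_def)
      with 2 wrap1 n2 show ?thesis by auto
    next
      case 3
      then have "(i + n - 1) mod n = i - 1" "(i + 1) mod n = i + 1"
        by (simp_all add: mod_if)
      with i inner[OF 3(1)] show ?thesis by (simp add: T_def)
    qed
  qed
  from card_mono[OF _ this] have cardT: "card T \<le> (if n mod 4 = 0 then 0 else 1)"
    by (cases "n mod 4 = 0"; cases "n mod 4 = 1") auto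
  have union: "R \<union> B = Inl ` {..<n} \<union> Inr ` T"
    by (auto simp: R_def B_def)
  have "card (R \<union> B) \<le> n + card T"
    unfolding union by (intro order_trans[OF card_Un_le]) (simp add: card_image)
  with cardT have "card (R \<union> B) \<le> (if n mod 4 = 0 then n else n + 1)"
    by (auto split: if_splits)
  moreover have "ds_dominating (splitting_graph (cycle_graph n)) (R \<union> B)"
  proof (rule ds_dominating_splitting_cycleI[OF n])
    show "R \<union> B \<subseteq> Inl ` {..<n} \<union> Inr ` {..<n}" "R \<inter> B = {}"
      by (auto simp: R_def B_def T_def)
    have "Inl 0 \<in> R" "Inl 2 \<in> B"
      using n by (auto simp: R_def B_def c_def)
    then show "R \<noteq> {}" "B \<noteq> {}" by auto
  next
    fix i assume "i < n" "Inl i \<notin> R \<union> B"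
    then show "{Inl ((i + n - 1) mod n), Inl ((i + 1) mod n),
            Inr ((i + n - 1) mod n), Inr ((i + 1) mod n)} \<inter> R \<noteq> {} \<and>
           {Inl ((i + n - 1) mod n), Inl ((i + 1) mod n),
            Inr ((i + n - 1) mod n), Inr ((i + 1) mod n)} \<inter> B \<noteq> {}"
      unfolding union by auto
  next
    fix i assume i: "i < n" "Inr i \<notin> R \<union> B"
    then have "c ((i + n - 1) mod n) \<noteq> c ((i + 1) mod n)"
      unfolding union by (auto simp: T_def)
    moreover have "(i + n - 1) mod n < n" "(i + 1) mod n < n"
      using n by auto
    ultimately show "{Inl ((i + n - 1) mod n), Inl ((i + 1) mod n)} \<inter> R \<noteq> {} \<and>
           {Inl ((i + n - 1) mod n), Inl ((i + 1) mod n)} \<inter> B \<noteq> {}"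
      by (cases "c ((i + 1) mod n)") (auto simp: R_def B_def)
  qed
  ultimately show ?thesis by blast
qed

text \<open>Originals of odd index are dominated by an even original and its oppositely coloured twin.
  A twin of odd index \<open>i\<close> sees one original of each residue \<open>0\<close> and \<open>2\<close> modulo \<open>4\<close>, except for
  \<open>i = n - 1\<close>, whose neighbours \<open>n - 2\<close> and \<open>0\<close> are both divisible by \<open>4\<close>; that twin is added.\<close>

lemma exists_ds_dominating_2_mod_4:
  assumes n: "n \<ge> 3" and n2: "n mod 4 = 2"
  shows "\<exists>S. ds_dominating (splitting_graph (cycle_graph n)) S \<and> card S \<le> n + 1"
proof -
  define R :: "(nat + nat) set" where
    "R = Inl ` {i. i < n \<and> i mod 4 = 0} \<union> Inr ` {i. i < n \<and> (i mod 4 = 2 \<or> i = n - 1)}"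
  define B :: "(nat + nat) set" where
    "B = Inl ` {i. i < n \<and> i mod 4 = 2} \<union> Inr ` {i. i < n \<and> i mod 4 = 0}"
  define E where "E = (\<lambda>k. 2 * k) ` {..<n div 2}"
  have "even n" using n2 by presburger
  have cardE: "card E = n div 2"
    by (simp add: E_def card_image inj_on_def)
  have E: "i \<in> E \<longleftrightarrow> i < n \<and> even i" for i
    using \<open>even n\<close> by (auto simp: E_def elim!: evenE)
  have ev: "i mod 4 = 0 \<or> i mod 4 = 2 \<longleftrightarrow> even i" for i :: nat
    by presburger
  have "R \<union> B \<subseteq> Inl ` E \<union> Inr ` insert (n - 1) E"
  proof (rule subsetI)
    fix x assume "x \<in> R \<union> B"
    then show "x \<in> Inl ` E \<union> Inr ` insert (n - 1) E"
      using ev by (cases x) (auto simp: R_def B_def E simp flip: ev)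
  qed
  then have "card (R \<union> B) \<le> card (Inl ` E \<union> Inr ` insert (n - 1) E)"
    by (intro card_mono) (auto simp: E_def)
  also have "\<dots> \<le> card (Inl ` E :: (nat + nat) set) + card (Inr ` insert (n - 1) E :: (nat + nat) set)"
    by (rule card_Un_le)
  also have "\<dots> \<le> card E + card (insert (n - 1) E)"
    by (intro add_mono card_image_le) (simp_all add: E_def)
  also have "\<dots> \<le> n + 1"
    using card_insert_le_m1[of "Suc (card E)" E "n - 1"] cardE \<open>even n\<close> by auto
  finally have "card (R \<union> B) \<le> n + 1" .
  moreover have "ds_dominating (splitting_graph (cycle_graph n)) (R \<union> B)"
  proof (rule ds_dominating_splitting_cycleI[OF n])
    have "odd (n - 1)" using n \<open>even n\<close> by simp
    then have "(n - 1) mod 4 \<noteq> 0" by presburger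
    then show "R \<inter> B = {}"
      by (auto simp: R_def B_def)
    show "R \<union> B \<subseteq> Inl ` {..<n} \<union> Inr ` {..<n}"
      by (auto simp: R_def B_def)
    have "Inl 0 \<in> R" "Inl 2 \<in> B"
      using n by (auto simp: R_def B_def)
    then show "R \<noteq> {}" "B \<noteq> {}" by auto
  next
    fix i assume i: "i < n" "Inl i \<notin> R \<union> B"
    let ?k = "(i + 1) mod n"
    have "odd i"
      using i ev[of i] by (auto simp: R_def B_def)
    then have "even ?k" "?k < n"
      using \<open>even n\<close> n by (simp_all add: dvd_mod_iff)
    then have "Inl ?k \<in> R \<and> Inr ?k \<in> B \<or> Inl ?k \<in> B \<and> Inr ?k \<in> R"
      using ev[of ?k] by (auto simp: R_def B_def)
    then show "{Inl ((i + n - 1) mod n), Inl ((i + 1) mod n),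
            Inr ((i + n - 1) mod n), Inr ((i + 1) mod n)} \<inter> R \<noteq> {} \<and>
           {Inl ((i + n - 1) mod n), Inl ((i + 1) mod n),
            Inr ((i + n - 1) mod n), Inr ((i + 1) mod n)} \<inter> B \<noteq> {}"
      by blast
  next
    fix i assume i: "i < n" "Inr i \<notin> R \<union> B"
    have "odd i" "i \<noteq> n - 1"
      using i ev[of i] by (auto simp: R_def B_def)
    then have "0 < i" "i + 1 < n"
      using i(1) by (auto intro: Nat.gr0I)
    then have eqs: "(i + n - 1) mod n = i - 1" "(i + 1) mod n = i + 1"
      by (simp_all add: mod_if)
    have "(i - 1) mod 4 = 0 \<and> (i + 1) mod 4 = 2 \<or> (i - 1) mod 4 = 2 \<and> (i + 1) mod 4 = 0"
    proof -
      have "i mod 4 = 1 \<or> i mod 4 = 3"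
        using \<open>odd i\<close> by presburger
      then show ?thesis
        by (cases i) (auto simp: mod_Suc split: if_splits)
    qed
    moreover have "i - 1 < n"
      using i(1) by simp
    ultimately show "{Inl ((i + n - 1) mod n), Inl ((i + 1) mod n)} \<inter> R \<noteq> {} \<and>
           {Inl ((i + n - 1) mod n), Inl ((i + 1) mod n)} \<inter> B \<noteq> {}"
      unfolding eqs using \<open>i + 1 < n\<close> by (auto simp: R_def B_def)
  qed
  ultimately show ?thesis by blast
qed

section \<open>The domination number\<close>

theorem theorem2p2:
  fixes n :: nat
  assumes "n \<ge> 3"
  shows "ds_domination_number (splitting_graph (cycle_graph n)) =
           (if n mod 4 = 0 then n else n + 1)"
proof -
  let ?G = "splitting_graph (cycle_graph n)"
  let ?k = "if n mod 4 = 0 then n else n + 1"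
  have lower: "?k \<le> card S" if "ds_dominating ?G S" for S
    using ds_dominating_splitting_cycle_card[OF assms that]
    by (cases "card S = n") (auto simp: dvd_eq_mod_eq_0)
  obtain S where S: "ds_dominating ?G S" "card S \<le> ?k"
  proof (cases "n mod 4 = 2")
    case True
    then show ?thesis
      using exists_ds_dominating_2_mod_4[OF assms True] that by auto
  next
    case False
    then show ?thesis
      using exists_ds_dominating_not_2_mod_4[OF assms False] that by blast
  qed
  with lower have "card S = ?k"
    by (intro le_antisym)
  then show ?thesis
    unfolding ds_domination_number_def using S(1) lower by (intro Least_equality) auto
qed

end
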